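(* Let $(M,X)$ be a dynamical system, $\Pi:M\rightarrow N$ a fibration and $\Sigma:N\times\Lambda\rightarrow M$ a complete solution of the $\Pi$-HJE for $(M,X)$. Then, for every $m\in M$ there exist an open neighborhood $U$ of $m$ and a fibration $F:U\rightarrow F(U)\subset\Lambda$ such that $$\operatorname{Im} X|_U\subset\operatorname{Ker}F_{\ast}$$ and $F$ is transverse to $\Pi|_U$, i.e. $$TU=\operatorname{Ker}(\Pi|_U)_{\ast}\oplus\operatorname{Ker}F_{\ast}.$$ Moreover, $U$ and $F$ can be taken such that: 1. $\Sigma(\Pi(U)\times F(U))\subset U$; 2. $\Sigma|_{\Pi(U)\times F(U)}$ is a global diffeomorphism onto $U$; 3. $F\circ\Sigma|_{\Pi(U)\times F(U)}=p_{\Lambda}|_{\Pi(U)\times F(U)}$, where $p_\Lambda:N\times\Lambda\to\Lambda$ is the canonical projection.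
   Context: All manifolds are smooth and finite-dimensional and all maps are smooth; $f_*$ denotes the tangent map of $f$. A fibration is a surjective submersion. A dynamical system $(M,X)$ is a manifold $M$ with a vector field $X$ on $M$. Given a fibration $\Pi:M\to N$, a section $\sigma:N\to M$ of $\Pi$ is a solution of the $\Pi$-Hamilton-Jacobi equation ($\Pi$-HJE) for $(M,X)$ if $\sigma_{\ast}\circ\Pi_{\ast}\circ X\circ\sigma=X\circ\sigma$. Let $\Lambda$ be a manifold of dimension $\dim M-\dim N$. A complete solution of the $\Pi$-HJE for $(M,X)$ is a surjective local diffeomorphism $\Sigma:N\times\Lambda\to M$ such that, for each $\lambda\in\Lambda$, the map $\sigma_\lambda:=\Sigma(\cdot,\lambda):N\to M$ is a section of $\Pi$ that is a solution of the $\Pi$-HJE for $(M,X)$. *)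

theory Defs
  imports "HOL-Analysis.Analysis" "HOL-Library.Function_Algebras"
begin

section \<open>Model spaces\<close>

text \<open>
  Manifolds are modelled on finite-dimensional real inner product spaces. The class
  \<^class>\<open>euclidean_space\<close> is not used for this purpose because it forces the dimension to be
  positive, whereas a fibration may have a base or fibres of dimension 0.
\<close>

class model_space = real_inner +
  assumes finite_dimensional: "\<exists>B. finite B \<and> (\<forall>x. \<exists>c. x = (\<Sum>b\<in>B. c b *\<^sub>R b))"

lemma model_space_span: "\<exists>B. finite B \<and> span B = (UNIV :: 'a::model_space set)"
proof -
  obtain B :: "'a set" where "finite B" and B: "\<forall>x. \<exists>c. x = (\<Sum>b\<in>B. c b *\<^sub>R b)"
    using finite_dimensional by blast
  have "x \<in> span B" for x
  proof -
    obtain c where "x = (\<Sum>b\<in>B. c b *\<^sub>R b)"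
      using B by blast
    moreover have "(\<Sum>b\<in>B. c b *\<^sub>R b) \<in> span B"
      by (intro span_sum span_scale span_base)
    ultimately show ?thesis
      by simp
  qed
  with \<open>finite B\<close> show ?thesis
    by blast
qed

text \<open>The model space of dimension 0.\<close>

instantiation unit :: real_inner
begin
definition "scaleR_unit (r::real) (x::unit) = ()"
definition "plus_unit (x::unit) (y::unit) = ()"
definition "minus_unit (x::unit) (y::unit) = ()"
definition "uminus_unit (x::unit) = ()"
definition "zero_unit = ()"
definition "norm_unit (x::unit) = (0::real)"
definition "sgn_unit (x::unit) = ()"
definition "dist_unit (x::unit) (y::unit) = (0::real)"
definition "inner_unit (x::unit) (y::unit) = (0::real)"
definition "uniformity_unit = (INF e\<in>{0<..}. principal {(x::unit, y). dist x y < e})"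
definition "open_unit (U::unit set) \<longleftrightarrow> True"
instance
  by standard
    (auto simp: dist_unit_def norm_unit_def inner_unit_def uniformity_unit_def open_unit_def eventually_principal top_unit_def
     intro!: eventually_INF1[of 1])
end
instance unit :: model_space
  by standard (auto intro!: exI[of _ "{}"])

instance euclidean_space \<subseteq> model_space
proof
  have "x = (\<Sum>b\<in>Basis. (x \<bullet> b) *\<^sub>R b)" for x :: 'a
    by (simp add: euclidean_representation)
  then show "\<exists>B. finite B \<and> (\<forall>x::'a. \<exists>c. x = (\<Sum>b\<in>B. c b *\<^sub>R b))"
    by (intro exI[of _ Basis] conjI finite_Basis allI exI)
qed

instance prod :: (model_space, model_space) model_space
proof
  obtain A :: "'a set" where A: "finite A" "span A = UNIV"
    using model_space_span by blast
  obtain B :: "'b set" where B: "finite B" "span B = UNIV"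
    using model_space_span by blast
  let ?C = "(\<lambda>x. (x, 0)) ` A \<union> (\<lambda>y. (0, y)) ` B"
  have fin: "finite ?C"
    using A B by simp
  have l1: "linear (\<lambda>x::'a. (x, 0::'b))" and l2: "linear (\<lambda>y::'b. (0::'a, y))"
    by (auto intro!: linearI)
  have 1: "(x, 0) \<in> span ?C" for x
  proof -
    have "(x, 0) \<in> (\<lambda>x. (x, 0::'b)) ` span A"
      using A by simp
    also have "\<dots> = span ((\<lambda>x. (x, 0::'b)) ` A)"
      by (rule linear_span_image[OF l1, symmetric])
    also have "\<dots> \<subseteq> span ?C"
      by (rule span_mono) simp
    finally show ?thesis .
  qed
  have 2: "(0, y) \<in> span ?C" for y
  proof -
    have "(0, y) \<in> (\<lambda>y. (0::'a, y)) ` span B"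
      using B by simp
    also have "\<dots> = span ((\<lambda>y. (0::'a, y)) ` B)"
      by (rule linear_span_image[OF l2, symmetric])
    also have "\<dots> \<subseteq> span ?C"
      by (rule span_mono) simp
    finally show ?thesis .
  qed
  have "z \<in> span ?C" for z
    using span_add[OF 1[of "fst z"] 2[of "snd z"]] by simp
  then have "\<exists>c. z = (\<Sum>b\<in>?C. c b *\<^sub>R b)" for z
    unfolding span_finite[OF fin] by blast
  with fin show "\<exists>B. finite B \<and> (\<forall>x::'a \<times> 'b. \<exists>c. x = (\<Sum>b\<in>B. c b *\<^sub>R b))"
    by blast
qed


section \<open>Smooth functions between model spaces\<close>

text \<open>
  As the domain is finite-dimensional, a function is of class \<open>C\<^sup>k\<^sup>+\<^sup>1\<close> on an open set iff it is
  differentiable there and all its directional derivatives are of class \<open>C\<^sup>k\<close>.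
\<close>

fun Ck_on :: "nat \<Rightarrow> 'a::model_space set \<Rightarrow> ('a \<Rightarrow> 'b::model_space) \<Rightarrow> bool" where
  "Ck_on 0 S f \<longleftrightarrow> continuous_on S f"
| "Ck_on (Suc k) S f \<longleftrightarrow>
     (\<forall>x\<in>S. f differentiable (at x)) \<and> (\<forall>v. Ck_on k S (\<lambda>x. frechet_derivative f (at x) v))"

definition smooth_on :: "'a::model_space set \<Rightarrow> ('a \<Rightarrow> 'b::model_space) \<Rightarrow> bool" where
  "smooth_on S f \<longleftrightarrow> (\<forall>k. Ck_on k S f)"


section \<open>Smooth manifolds\<close>

text \<open>
  A chart is a pair \<open>(U, \<phi>)\<close>; only the values of \<open>\<phi>\<close> on \<open>U\<close> are relevant. Atlases are not
  required to be maximal: replacing an atlas by a compatible one changes the notions below only by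
  the canonical identification of tangent vectors.
\<close>

type_synonym ('p, 'e) chart = "'p set \<times> ('p \<Rightarrow> 'e)"

record ('p, 'e) manifold =
  mtop :: "'p topology"
  atlas :: "('p, 'e) chart set"

abbreviation mspc :: "('p, 'e) manifold \<Rightarrow> 'p set" where
  "mspc M \<equiv> topspace (mtop M)"

definition chart_inv :: "('p, 'e) chart \<Rightarrow> 'e \<Rightarrow> 'p" where
  "chart_inv c = inv_into (fst c) (snd c)"

definition smooth_manifold :: "('p, 'e::model_space) manifold \<Rightarrow> bool" where
  "smooth_manifold M \<longleftrightarrow>
     Hausdorff_space (mtop M) \<and> second_countable (mtop M) \<and>
     (\<Union>c\<in>atlas M. fst c) = mspc M \<and>
     (\<forall>(U, \<phi>)\<in>atlas M. openin (mtop M) U \<and> open (\<phi> ` U) \<and>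
        homeomorphic_map (subtopology (mtop M) U) (top_of_set (\<phi> ` U)) \<phi>) \<and>
     (\<forall>(U, \<phi>)\<in>atlas M. \<forall>(V, \<psi>)\<in>atlas M. smooth_on (\<phi> ` (U \<inter> V)) (\<psi> \<circ> chart_inv (U, \<phi>)))"

definition mdim :: "('p, 'e::model_space) manifold \<Rightarrow> nat" where
  "mdim M = dim (UNIV :: 'e set)"

definition prod_manifold ::
    "('p, 'e) manifold \<Rightarrow> ('q, 'f) manifold \<Rightarrow> ('p \<times> 'q, 'e \<times> 'f) manifold" where
  "prod_manifold M N =
     \<lparr>mtop = prod_topology (mtop M) (mtop N),
      atlas = {(U \<times> V, map_prod \<phi> \<psi>) | U \<phi> V \<psi>. (U, \<phi>) \<in> atlas M \<and> (V, \<psi>) \<in> atlas N}\<rparr>"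

text \<open>
  Open subsets are regarded as open submanifolds: \<open>smooth_map M A N B f\<close> says that \<open>f\<close> is a smooth
  map from the open submanifold \<open>A\<close> of \<open>M\<close> to the open submanifold \<open>B\<close> of \<open>N\<close>.
\<close>

definition smooth_map ::
    "('p, 'e::model_space) manifold \<Rightarrow> 'p set \<Rightarrow> ('q, 'f::model_space) manifold \<Rightarrow> 'q set
      \<Rightarrow> ('p \<Rightarrow> 'q) \<Rightarrow> bool" where
  "smooth_map M A N B f \<longleftrightarrow>
     openin (mtop M) A \<and> openin (mtop N) B \<and>
     continuous_map (subtopology (mtop M) A) (subtopology (mtop N) B) f \<and>
     (\<forall>(U, \<phi>)\<in>atlas M. \<forall>(V, \<psi>)\<in>atlas N.
        smooth_on (\<phi> ` (A \<inter> U \<inter> f -` V)) (\<psi> \<circ> f \<circ> chart_inv (U, \<phi>)))"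

definition diffeomorphism ::
    "('p, 'e::model_space) manifold \<Rightarrow> 'p set \<Rightarrow> ('q, 'f::model_space) manifold \<Rightarrow> 'q set
      \<Rightarrow> ('p \<Rightarrow> 'q) \<Rightarrow> bool" where
  "diffeomorphism M A N B f \<longleftrightarrow>
     bij_betw f A B \<and> smooth_map M A N B f \<and> smooth_map N B M A (inv_into A f)"

definition local_diffeomorphism ::
    "('p, 'e::model_space) manifold \<Rightarrow> ('q, 'f::model_space) manifold \<Rightarrow> ('p \<Rightarrow> 'q) \<Rightarrow> bool" where
  "local_diffeomorphism M N f \<longleftrightarrow>
     (\<forall>p\<in>mspc M. \<exists>A B. p \<in> A \<and> diffeomorphism M A N B f)"


section \<open>Tangent vectors\<close>

definition charts_at :: "('p, 'e) manifold \<Rightarrow> 'p \<Rightarrow> ('p, 'e) chart set" where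
  "charts_at M p = {c \<in> atlas M. p \<in> fst c}"

text \<open>
  A tangent vector at \<open>p\<close> is a family of coordinate vectors, one for each chart around \<open>p\<close>, which
  transform by the derivatives of the coordinate changes. (The components at all other charts are
  set to 0.) Addition of tangent vectors at \<open>p\<close> is pointwise, as in \<^theory>\<open>HOL-Library.Function_Algebras\<close>.
\<close>

definition tangent_space ::
    "('p, 'e::model_space) manifold \<Rightarrow> 'p \<Rightarrow> (('p, 'e) chart \<Rightarrow> 'e) set" where
  "tangent_space M p =
     {v. (\<forall>c. c \<notin> charts_at M p \<longrightarrow> v c = 0) \<and>
         (\<forall>c\<in>charts_at M p. \<forall>d\<in>charts_at M p.
            v d = frechet_derivative (snd d \<circ> chart_inv c) (at (snd c p)) (v c))}"

text \<open>
  Elements of the tangent bundle are pairs of a base point and a tangent vector there. The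
  tangent space of an open submanifold at \<open>p\<close> is identified with that of the whole manifold.
\<close>

type_synonym ('p, 'e) tangent = "'p \<times> (('p, 'e) chart \<Rightarrow> 'e)"

text \<open>
  The tangent map is computed in an arbitrary chart around the base point; for tangent vectors
  the result is independent of that choice. It only depends on the germ of \<open>f\<close> at the base point, so
  it also serves for maps that are smooth on an open neighbourhood of that point only.
\<close>

definition tangent_map ::
    "('p, 'e::model_space) manifold \<Rightarrow> ('q, 'f::model_space) manifold \<Rightarrow> ('p \<Rightarrow> 'q)
      \<Rightarrow> ('p, 'e) tangent \<Rightarrow> ('q, 'f) tangent" where
  "tangent_map M N f = (\<lambda>(p, v).
     (f p, \<lambda>d. if d \<in> charts_at N (f p)
               then let c = (SOME c. c \<in> charts_at M p)
                    in frechet_derivative (snd d \<circ> f \<circ> chart_inv c) (at (snd c p)) (v c)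
               else 0))"

definition vector_field ::
    "('p, 'e::model_space) manifold \<Rightarrow> ('p \<Rightarrow> ('p, 'e) tangent) \<Rightarrow> bool" where
  "vector_field M X \<longleftrightarrow>
     (\<forall>p\<in>mspc M. fst (X p) = p \<and> snd (X p) \<in> tangent_space M p) \<and>
     (\<forall>(U, \<phi>)\<in>atlas M. smooth_on (\<phi> ` U) (\<lambda>x. snd (X (chart_inv (U, \<phi>) x)) (U, \<phi>)))"

definition tangent_kernel ::
    "('p, 'e::model_space) manifold \<Rightarrow> ('q, 'f::model_space) manifold \<Rightarrow> ('p \<Rightarrow> 'q) \<Rightarrow> 'p
      \<Rightarrow> (('p, 'e) chart \<Rightarrow> 'e) set" where
  "tangent_kernel M N f p = {v \<in> tangent_space M p. snd (tangent_map M N f (p, v)) = 0}"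

definition tangent_kernel_bundle ::
    "('p, 'e::model_space) manifold \<Rightarrow> 'p set \<Rightarrow> ('q, 'f::model_space) manifold \<Rightarrow> ('p \<Rightarrow> 'q)
      \<Rightarrow> ('p, 'e) tangent set" where
  "tangent_kernel_bundle M U N f = Sigma U (tangent_kernel M N f)"

definition direct_sum :: "'v::ab_group_add set \<Rightarrow> 'v set \<Rightarrow> 'v set \<Rightarrow> bool" where
  "direct_sum V A B \<longleftrightarrow> V = {a + b | a b. a \<in> A \<and> b \<in> B} \<and> A \<inter> B = {0}"


section \<open>Fibrations and the Hamilton--Jacobi equation\<close>

definition fibration ::
    "('p, 'e::model_space) manifold \<Rightarrow> 'p set \<Rightarrow> ('q, 'f::model_space) manifold \<Rightarrow> 'q set
      \<Rightarrow> ('p \<Rightarrow> 'q) \<Rightarrow> bool" where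
  "fibration M A N B f \<longleftrightarrow>
     smooth_map M A N B f \<and> f ` A = B \<and>
     (\<forall>p\<in>A. tangent_map M N f ` ({p} \<times> tangent_space M p) = {f p} \<times> tangent_space N (f p))"

definition transverse ::
    "('p, 'e::model_space) manifold \<Rightarrow> 'p set \<Rightarrow> ('q, 'f::model_space) manifold \<Rightarrow> ('p \<Rightarrow> 'q)
      \<Rightarrow> ('r, 'g::model_space) manifold \<Rightarrow> ('p \<Rightarrow> 'r) \<Rightarrow> bool" where
  "transverse M U N f L g \<longleftrightarrow>
     (\<forall>p\<in>U. direct_sum (tangent_space M p) (tangent_kernel M N f p) (tangent_kernel M L g p))"

definition dynamical_system ::
    "('m, 'a::model_space) manifold \<Rightarrow> ('m \<Rightarrow> ('m, 'a) tangent) \<Rightarrow> bool" where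
  "dynamical_system M X \<longleftrightarrow> smooth_manifold M \<and> vector_field M X"

definition smooth_section ::
    "('m, 'a::model_space) manifold \<Rightarrow> ('n, 'b::model_space) manifold \<Rightarrow> ('m \<Rightarrow> 'n)
      \<Rightarrow> ('n \<Rightarrow> 'm) \<Rightarrow> bool" where
  "smooth_section M N Pr \<sigma> \<longleftrightarrow>
     smooth_map N (mspc N) M (mspc M) \<sigma> \<and> (\<forall>n\<in>mspc N. Pr (\<sigma> n) = n)"

definition HJE_solution ::
    "('m, 'a::model_space) manifold \<Rightarrow> ('m \<Rightarrow> ('m, 'a) tangent)
      \<Rightarrow> ('n, 'b::model_space) manifold \<Rightarrow> ('m \<Rightarrow> 'n) \<Rightarrow> ('n \<Rightarrow> 'm) \<Rightarrow> bool" where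
  "HJE_solution M X N Pr \<sigma> \<longleftrightarrow>
     smooth_section M N Pr \<sigma> \<and>
     (\<forall>n\<in>mspc N. (tangent_map N M \<sigma> \<circ> tangent_map M N Pr \<circ> X \<circ> \<sigma>) n = (X \<circ> \<sigma>) n)"

definition complete_solution ::
    "('m, 'a::model_space) manifold \<Rightarrow> ('m \<Rightarrow> ('m, 'a) tangent)
      \<Rightarrow> ('n, 'b::model_space) manifold \<Rightarrow> ('m \<Rightarrow> 'n)
      \<Rightarrow> ('l, 'c::model_space) manifold \<Rightarrow> ('n \<times> 'l \<Rightarrow> 'm) \<Rightarrow> bool" where
  "complete_solution M X N Pr \<Lambda> \<Sigma> \<longleftrightarrow>
     smooth_manifold \<Lambda> \<and> mdim N + mdim \<Lambda> = mdim M \<and>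
     local_diffeomorphism (prod_manifold N \<Lambda>) M \<Sigma> \<and> \<Sigma> ` (mspc N \<times> mspc \<Lambda>) = mspc M \<and>
     (\<forall>l\<in>mspc \<Lambda>. HJE_solution M X N Pr (\<lambda>n. \<Sigma> (n, l)))"

end

theory Submission
  imports Defs
begin

text \<open>
  Since \<open>\<Sigma>\<close> is a surjective local diffeomorphism, \<open>m = \<Sigma> (n\<^sub>0, l\<^sub>0)\<close> for some point
  \<open>(n\<^sub>0, l\<^sub>0)\<close>, and \<open>\<Sigma>\<close> is a diffeomorphism from some box \<open>V \<times> W\<close> around that point onto an open
  set \<open>U\<close> (\<open>diffeomorphism_restrict\<close>). Let \<open>G\<close> be its inverse and \<open>F\<close> the \<open>\<Lambda>\<close>-component of \<open>G\<close>. Each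
  \<open>\<Sigma> (\<cdot>, l)\<close> is a section of \<open>Pr\<close>, so \<open>Pr\<close> is the \<open>N\<close>-component of \<open>G\<close> on \<open>U\<close>. Hence \<open>G = (Pr, F)\<close>,
  \<open>Pr ` U = V\<close> and \<open>F ` U = W\<close>: through \<open>\<Sigma>\<close>, the maps \<open>Pr\<close> and \<open>F\<close> are the two projections of the
  box, which gives the assertions about \<open>\<Sigma>\<close> restricted to \<open>Pr ` U \<times> F ` U\<close>.

  The infinitesimal assertions follow from the chain rule (\<open>differential_comp\<close>). As
  \<open>F \<circ> \<Sigma> = snd\<close> on the box, the differential of \<open>F\<close> is onto because that of \<open>snd\<close> is. Along a leaf
  \<open>\<sigma> = \<Sigma> (\<cdot>, l)\<close> the function \<open>F\<close> is constant, so the image of the differential of \<open>\<sigma>\<close> lies in the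
  kernel of that of \<open>F\<close>; the Hamilton--Jacobi equation says that \<open>X\<close> takes its values along the leaf in
  this image. The same differential is a right inverse of that of \<open>Pr\<close>, so every tangent vector \<open>v\<close> is
  the sum of \<open>v - \<sigma>\<^sub>* Pr\<^sub>* v\<close>, which \<open>Pr\<^sub>*\<close> kills, and \<open>\<sigma>\<^sub>* Pr\<^sub>* v\<close>, which \<open>F\<^sub>*\<close> kills. A vector in both
  kernels is killed by both components of \<open>G\<^sub>*\<close> (\<open>tangent_prod_eq_zero\<close>), so it is
  0 because \<open>\<Sigma>\<^sub>* G\<^sub>* = id\<close>.

  Smoothness of \<open>F\<close> amounts to composing the smooth map \<open>G\<close> with a projection, which in coordinates is
  bounded linear and so commutes with taking directional derivatives of any order.
\<close>

section \<open>Smooth functions on open sets\<close>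

lemma Ck_on_subset: "Ck_on k S f \<Longrightarrow> T \<subseteq> S \<Longrightarrow> Ck_on k T f"
  by (induction k arbitrary: f) (auto intro: continuous_on_subset)

lemma Ck_on_cong:
  assumes "open S" and "\<And>x. x \<in> S \<Longrightarrow> f x = g x" and "Ck_on k S f"
  shows "Ck_on k S g"
  using assms(2,3)
proof (induction k arbitrary: f g)
  case 0
  then show ?case
    using continuous_on_cong by fastforce
next
  case (Suc k)
  have "g differentiable (at x)" if "x \<in> S" for x
    using Suc.prems that \<open>open S\<close> has_derivative_transform_within_open[of f _ x UNIV S g]
    unfolding differentiable_def Ck_on.simps by blast
  moreover have "Ck_on k S (\<lambda>x. frechet_derivative g (at x) v)" for v
  proof (rule Suc.IH)
    show "Ck_on k S (\<lambda>x. frechet_derivative f (at x) v)"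
      using Suc.prems by simp
    show "frechet_derivative f (at x) v = frechet_derivative g (at x) v" if "x \<in> S" for x
      using frechet_derivative_transform_within_open[of f x S g] Suc.prems that \<open>open S\<close> by simp
  qed
  ultimately show ?case
    by simp
qed

lemma Ck_on_open_Union:
  assumes "\<And>T. T \<in> C \<Longrightarrow> open T \<and> Ck_on k T f"
  shows "Ck_on k (\<Union>C) f"
  using assms
proof (induction k arbitrary: f)
  case 0
  then show ?case
    by (auto intro: continuous_on_open_Union)
qed auto

text \<open>
  The derivative of \<open>h \<circ> f\<close> in a direction is \<open>h\<close> applied to that of \<open>f\<close>, so the induction on the order
  of differentiability stays within maps of the form \<open>h \<circ> g\<close>.
\<close>

lemma Ck_on_bounded_linear:
  assumes "bounded_linear h" and "open S" and "Ck_on k S f"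
  shows "Ck_on k S (h \<circ> f)"
  using assms(3)
proof (induction k arbitrary: f)
  case 0
  then show ?case
    using assms(1) by (auto simp: o_def intro: bounded_linear.continuous_on)
next
  case (Suc k)
  have D: "((h \<circ> f) has_derivative (\<lambda>v. h (frechet_derivative f (at x) v))) (at x)" if "x \<in> S" for x
    using Suc.prems that bounded_linear.has_derivative[OF assms(1)]
    unfolding o_def Ck_on.simps frechet_derivative_works by blast
  have "Ck_on k S (\<lambda>x. frechet_derivative (h \<circ> f) (at x) v)" for v
  proof (rule Ck_on_cong[OF \<open>open S\<close>])
    show "Ck_on k S (h \<circ> (\<lambda>x. frechet_derivative f (at x) v))"
      using Suc.prems by (intro Suc.IH) simp
    show "(h \<circ> (\<lambda>x. frechet_derivative f (at x) v)) x = frechet_derivative (h \<circ> f) (at x) v"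
      if "x \<in> S" for x
      using frechet_derivative_at[OF D[OF that]] by (simp add: fun_eq_iff)
  qed
  with D show ?case
    unfolding Ck_on.simps differentiable_def by blast
qed

lemma smooth_on_subset: "smooth_on S f \<Longrightarrow> T \<subseteq> S \<Longrightarrow> smooth_on T f"
  by (auto simp: smooth_on_def intro: Ck_on_subset)

lemma smooth_on_cong: "open S \<Longrightarrow> (\<And>x. x \<in> S \<Longrightarrow> f x = g x) \<Longrightarrow> smooth_on S f \<Longrightarrow> smooth_on S g"
  unfolding smooth_on_def by (blast intro: Ck_on_cong)

lemma smooth_on_open_Union:
  "(\<And>T. T \<in> C \<Longrightarrow> open T \<and> smooth_on T f) \<Longrightarrow> smooth_on (\<Union>C) f"
  unfolding smooth_on_def by (blast intro: Ck_on_open_Union)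

lemma smooth_on_bounded_linear:
  "bounded_linear h \<Longrightarrow> open S \<Longrightarrow> smooth_on S f \<Longrightarrow> smooth_on S (h \<circ> f)"
  by (simp add: smooth_on_def Ck_on_bounded_linear)

lemma smooth_on_imp_differentiable: "smooth_on S f \<Longrightarrow> x \<in> S \<Longrightarrow> f differentiable (at x)"
  unfolding smooth_on_def using Ck_on.simps(2) by blast

section \<open>Charts and restrictions of smooth maps\<close>

text \<open>
  First-order calculus makes sense on every space with an atlas of open charts whose coordinate
  changes are differentiable; products of such spaces are again of this kind, since product charts
  change coordinates componentwise.
\<close>

definition differentiable_manifold :: "('p, 'e::model_space) manifold \<Rightarrow> bool" where
  "differentiable_manifold M \<longleftrightarrow>
     (\<Union>c\<in>atlas M. fst c) = mspc M \<and>
     (\<forall>c\<in>atlas M. openin (mtop M) (fst c) \<and> open (snd c ` fst c) \<and>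
        homeomorphic_map (subtopology (mtop M) (fst c)) (top_of_set (snd c ` fst c)) (snd c)) \<and>
     (\<forall>c\<in>atlas M. \<forall>d\<in>atlas M. \<forall>p\<in>fst c \<inter> fst d.
        (snd d \<circ> chart_inv c) differentiable (at (snd c p)))"

lemma smooth_imp_differentiable_manifold:
  "smooth_manifold M \<Longrightarrow> differentiable_manifold M"
  unfolding smooth_manifold_def differentiable_manifold_def
  by (force intro!: smooth_on_imp_differentiable)

context
  fixes M :: "('p, 'e::model_space) manifold" and c :: "('p, 'e) chart"
  assumes M: "differentiable_manifold M" and c: "c \<in> atlas M"
begin

lemma chart_homeomorphic:
  "homeomorphic_map (subtopology (mtop M) (fst c)) (top_of_set (snd c ` fst c)) (snd c)"
  using M c by (auto simp: differentiable_manifold_def)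

lemma chart_domain_open: "openin (mtop M) (fst c)"
  using M c by (auto simp: differentiable_manifold_def)

lemma chart_inj_on: "inj_on (snd c) (fst c)"
  using homeomorphic_imp_injective_map[OF chart_homeomorphic] openin_subset[OF chart_domain_open]
  by (simp add: Int_absorb1)

lemma chart_inv_chart [simp]: "p \<in> fst c \<Longrightarrow> chart_inv c (snd c p) = p"
  using chart_inj_on by (simp add: chart_inv_def)

lemma open_chart_image:
  assumes "openin (mtop M) A"
  shows "open (snd c ` (A \<inter> fst c))"
proof -
  have "openin (subtopology (mtop M) (fst c)) (A \<inter> fst c)"
    using assms by (rule openin_subtopology_Int)
  then have "openin (top_of_set (snd c ` fst c)) (snd c ` (A \<inter> fst c))"
    using homeomorphic_imp_open_map[OF chart_homeomorphic] by (simp add: open_map_def)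
  moreover have "open (snd c ` fst c)"
    using M c by (auto simp: differentiable_manifold_def)
  ultimately show ?thesis
    using openin_open_trans by blast
qed

end

lemma smooth_map_coord:
  assumes "smooth_map M A N B f" "c \<in> atlas M" "d \<in> atlas N"
  shows "smooth_on (snd c ` (A \<inter> fst c \<inter> f -` fst d)) (snd d \<circ> f \<circ> chart_inv c)"
  using assms by (cases c; cases d) (fastforce simp: smooth_map_def)

lemma smooth_map_restrict:
  assumes f: "smooth_map M A N B f" and "openin (mtop M) A'" "A' \<subseteq> A"
    and "openin (mtop N) B'" "f ` A' \<subseteq> B'"
  shows "smooth_map M A' N B' f"
  unfolding smooth_map_def
proof (intro conjI assms)
  have "continuous_map (subtopology (mtop M) A) (mtop N) f"
    using f continuous_map_in_subtopology unfolding smooth_map_def by blast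
  then have "continuous_map (subtopology (mtop M) A') (mtop N) f"
    using \<open>A' \<subseteq> A\<close> by (rule continuous_map_from_subtopology_mono)
  then show "continuous_map (subtopology (mtop M) A') (subtopology (mtop N) B') f"
    using \<open>f ` A' \<subseteq> B'\<close> by (intro continuous_map_into_subtopology) auto
  show "\<forall>(U, \<phi>)\<in>atlas M. \<forall>(V, \<psi>)\<in>atlas N.
      smooth_on (\<phi> ` (A' \<inter> U \<inter> f -` V)) (\<psi> \<circ> f \<circ> chart_inv (U, \<phi>))"
    using f \<open>A' \<subseteq> A\<close> unfolding smooth_map_def
    by (fast elim!: smooth_on_subset)
qed

lemma open_preimage_smooth_map:
  assumes "smooth_map M A N B f" and "openin (mtop N) V"
  shows "openin (mtop M) (A \<inter> f -` V)"
proof -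
  have A: "openin (mtop M) A" and "continuous_map (subtopology (mtop M) A) (mtop N) f"
    using assms(1) continuous_map_in_subtopology unfolding smooth_map_def by blast+
  then have "openin (subtopology (mtop M) A) {x \<in> topspace (subtopology (mtop M) A). f x \<in> V}"
    using assms(2) openin_continuous_map_preimage by blast
  moreover have "{x \<in> topspace (subtopology (mtop M) A). f x \<in> V} = A \<inter> f -` V"
    using openin_subset[OF A] by auto
  ultimately show ?thesis
    using A openin_trans_full by metis
qed

text \<open>
  A smooth map may be changed arbitrarily off its domain. This is what makes inverses defined by
  \<^const>\<open>inv_into\<close> on different domains interchangeable.
\<close>

lemma smooth_map_cong:
  assumes M: "differentiable_manifold M" and N: "differentiable_manifold N"
    and f: "smooth_map M A N B f" and eq: "\<And>x. x \<in> A \<Longrightarrow> f x = g x"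
  shows "smooth_map M A N B g"
proof -
  have A: "openin (mtop M) A" and B: "openin (mtop N) B"
    using f by (auto simp: smooth_map_def)
  have "smooth_on (snd c ` (A \<inter> fst c \<inter> g -` fst d)) (snd d \<circ> g \<circ> chart_inv c)"
    if cd: "c \<in> atlas M" "d \<in> atlas N" for c d
  proof (rule smooth_on_cong)
    have *: "A \<inter> fst c \<inter> g -` fst d = (A \<inter> f -` fst d) \<inter> fst c"
      using eq by auto
    show "open (snd c ` (A \<inter> fst c \<inter> g -` fst d))"
      unfolding *
      by (intro open_chart_image[OF M] cd open_preimage_smooth_map[OF f] chart_domain_open[OF N])
    show "smooth_on (snd c ` (A \<inter> fst c \<inter> g -` fst d)) (snd d \<circ> f \<circ> chart_inv c)"
      using smooth_map_coord[OF f cd] unfolding * by (simp add: Int_ac)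
    show "(snd d \<circ> f \<circ> chart_inv c) x = (snd d \<circ> g \<circ> chart_inv c) x"
      if "x \<in> snd c ` (A \<inter> fst c \<inter> g -` fst d)" for x
      using that cd M eq by auto
  qed
  moreover have "continuous_map (subtopology (mtop M) A) (subtopology (mtop N) B) g"
    using f eq unfolding smooth_map_def by (auto intro: continuous_map_eq)
  ultimately show ?thesis
    using A B by (auto simp: smooth_map_def)
qed

text \<open>
  The image of \<open>A'\<close> is its preimage under the inverse, hence open; both directions are then
  restrictions of smooth maps.
\<close>

lemma diffeomorphism_restrict:
  assumes M: "differentiable_manifold M" and N: "differentiable_manifold N"
    and f: "diffeomorphism M A N B f" and A': "openin (mtop M) A'" "A' \<subseteq> A"
  shows "openin (mtop N) (f ` A')" and "diffeomorphism M A' N (f ` A') f"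
proof -
  have bij: "bij_betw f A B" and sf: "smooth_map M A N B f" and sg: "smooth_map N B M A (inv_into A f)"
    using f by (auto simp: diffeomorphism_def)
  have inv: "inv_into A f (f x) = x" if "x \<in> A" for x
    using bij that by (simp add: bij_betw_def)
  have "B \<inter> inv_into A f -` A' = f ` A'"
    using bij A' by (force simp: bij_betw_def inv)
  then show B': "openin (mtop N) (f ` A')"
    using open_preimage_smooth_map[OF sg A'(1)] by simp
  have inj: "inj_on f A'"
    using bij A' by (meson bij_betw_def inj_on_subset)
  have "smooth_map M A' N (f ` A') f"
    using smooth_map_restrict[OF sf A' B'] by simp
  moreover have "smooth_map N (f ` A') M A' (inv_into A f)"
    using bij A' by (intro smooth_map_restrict[OF sg B' _ A'(1)]) (auto simp: bij_betw_def inv)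
  then have "smooth_map N (f ` A') M A' (inv_into A' f)"
    by (rule smooth_map_cong[OF N M]) (use A' inj in \<open>auto simp: inv\<close>)
  ultimately show "diffeomorphism M A' N (f ` A') f"
    using inj by (auto simp: diffeomorphism_def bij_betw_def)
qed

section \<open>First-order calculus on manifolds\<close>

abbreviation coord_deriv ::
    "('p, 'e::model_space) chart \<Rightarrow> ('q, 'f::model_space) chart \<Rightarrow> ('p \<Rightarrow> 'q) \<Rightarrow> 'p \<Rightarrow> 'e \<Rightarrow> 'f" where
  "coord_deriv c d f p \<equiv> frechet_derivative (snd d \<circ> f \<circ> chart_inv c) (at (snd c p))"

text \<open>
  Continuity at \<open>p\<close> has to be demanded separately: if \<open>f\<close> leaves the domain of the chart \<open>d\<close> arbitrarily
  close to \<open>p\<close>, then \<open>snd d\<close> takes meaningless values there, and differentiability of the coordinate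
  expression gives no control of \<open>f\<close>.
\<close>

definition differentiable_map_at ::
    "('p, 'e::model_space) manifold \<Rightarrow> ('q, 'f::model_space) manifold \<Rightarrow> ('p \<Rightarrow> 'q) \<Rightarrow> 'p \<Rightarrow> bool" where
  "differentiable_map_at M N f p \<longleftrightarrow>
     p \<in> mspc M \<and> f p \<in> mspc N \<and>
     (\<forall>W. openin (mtop N) W \<and> f p \<in> W \<longrightarrow> (\<exists>A. openin (mtop M) A \<and> p \<in> A \<and> f ` A \<subseteq> W)) \<and>
     (\<forall>c\<in>charts_at M p. \<forall>d\<in>charts_at N (f p).
        (snd d \<circ> f \<circ> chart_inv c) differentiable (at (snd c p)))"

lemma differentiable_map_at_points:
  assumes "differentiable_map_at M N f p"
  shows "p \<in> mspc M" and "f p \<in> mspc N"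
  using assms by (auto simp: differentiable_map_at_def)

lemma differentiable_map_at_nbhd:
  assumes "differentiable_map_at M N f p" "openin (mtop N) W" "f p \<in> W"
  obtains A where "openin (mtop M) A" "p \<in> A" "f ` A \<subseteq> W"
proof -
  have "\<exists>A. openin (mtop M) A \<and> p \<in> A \<and> f ` A \<subseteq> W"
    using assms by (simp add: differentiable_map_at_def)
  then show thesis
    using that by blast
qed

lemma differentiable_map_at_coord:
  assumes "differentiable_map_at M N f p" "c \<in> charts_at M p" "d \<in> charts_at N (f p)"
  shows "(snd d \<circ> f \<circ> chart_inv c has_derivative coord_deriv c d f p) (at (snd c p))"
  using assms by (simp add: differentiable_map_at_def frechet_derivative_works)

lemma smooth_map_differentiable_at:
  assumes f: "smooth_map M A N B f" and "p \<in> A"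
  shows "differentiable_map_at M N f p"
  unfolding differentiable_map_at_def
proof (intro conjI allI ballI impI)
  have A: "openin (mtop M) A" and B: "openin (mtop N) B" and
    cont: "continuous_map (subtopology (mtop M) A) (subtopology (mtop N) B) f"
    using f by (auto simp: smooth_map_def)
  show "p \<in> mspc M"
    using A \<open>p \<in> A\<close> openin_subset by blast
  with cont \<open>p \<in> A\<close> show "f p \<in> mspc N"
    by (auto simp: continuous_map_def)
  show "\<exists>A. openin (mtop M) A \<and> p \<in> A \<and> f ` A \<subseteq> W" if "openin (mtop N) W \<and> f p \<in> W" for W
    using that open_preimage_smooth_map[OF f, of W] \<open>p \<in> A\<close> by blast
  show "(snd d \<circ> f \<circ> chart_inv c) differentiable (at (snd c p))"
    if cd: "c \<in> charts_at M p" "d \<in> charts_at N (f p)" for c d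
  proof (rule smooth_on_imp_differentiable)
    show "smooth_on (snd c ` (A \<inter> fst c \<inter> f -` fst d)) (snd d \<circ> f \<circ> chart_inv c)"
      using cd by (intro smooth_map_coord[OF f]) (auto simp: charts_at_def)
    show "snd c p \<in> snd c ` (A \<inter> fst c \<inter> f -` fst d)"
      using cd \<open>p \<in> A\<close> by (auto simp: charts_at_def)
  qed
qed

lemma ex_chart_at:
  assumes "differentiable_manifold M" "p \<in> mspc M"
  obtains c where "c \<in> charts_at M p"
proof -
  have "p \<in> (\<Union>c\<in>atlas M. fst c)"
    using assms by (simp add: differentiable_manifold_def)
  then show thesis
    using that by (auto simp: charts_at_def)
qed

lemma differentiable_map_at_cong:
  assumes M: "differentiable_manifold M" and f: "differentiable_map_at M N f p"
    and A: "openin (mtop M) A" "p \<in> A" and eq: "\<And>x. x \<in> A \<Longrightarrow> f x = g x"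
  shows "differentiable_map_at M N g p"
    and "c \<in> charts_at M p \<Longrightarrow> d \<in> charts_at N (f p) \<Longrightarrow> coord_deriv c d f p = coord_deriv c d g p"
proof -
  have gp: "g p = f p"
    using A eq by simp
  have nbhd: "open (snd c ` (A \<inter> fst c))" "snd c p \<in> snd c ` (A \<inter> fst c)"
    "x \<in> snd c ` (A \<inter> fst c) \<Longrightarrow> (snd d \<circ> f \<circ> chart_inv c) x = (snd d \<circ> g \<circ> chart_inv c) x"
    if "c \<in> charts_at M p" for c x and d :: "('c, 'd) chart"
    using that A M eq by (auto simp: charts_at_def intro: open_chart_image)
  have diff: "(snd d \<circ> f \<circ> chart_inv c) differentiable (at (snd c p))"
    if "c \<in> charts_at M p" "d \<in> charts_at N (f p)" for c d
    using f that by (auto simp: differentiable_map_at_def)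
  show "coord_deriv c d f p = coord_deriv c d g p" if "c \<in> charts_at M p" "d \<in> charts_at N (f p)" for c d
    using frechet_derivative_transform_within_open[OF diff[OF that] nbhd[OF that(1)]] .
  have "(snd d \<circ> g \<circ> chart_inv c) differentiable (at (snd c p))"
    if cd: "c \<in> charts_at M p" "d \<in> charts_at N (f p)" for c d
    unfolding differentiable_def
    by (rule exI, rule has_derivative_transform_within_open[OF differentiable_map_at_coord[OF f cd] nbhd[OF cd(1)]])
  moreover have "\<exists>A'. openin (mtop M) A' \<and> p \<in> A' \<and> g ` A' \<subseteq> W"
    if W: "openin (mtop N) W" "f p \<in> W" for W
  proof -
    obtain A' where "openin (mtop M) A'" "p \<in> A'" "f ` A' \<subseteq> W"
      using differentiable_map_at_nbhd[OF f W] .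
    then show ?thesis
      using A eq by (intro exI[of _ "A \<inter> A'"]) auto
  qed
  ultimately show "differentiable_map_at M N g p"
    using f gp by (auto simp: differentiable_map_at_def)
qed

lemma coord_deriv_linear:
  assumes "differentiable_map_at M N f p" "c \<in> charts_at M p" "d \<in> charts_at N (f p)"
  shows "linear (coord_deriv c d f p)"
  by (rule has_derivative_linear[OF differentiable_map_at_coord[OF assms]])

text \<open>
  Near \<open>p\<close> the map \<open>f\<close> stays in the domain of \<open>d\<close>, where \<open>chart_inv d\<close> cancels \<open>snd d\<close>. So the coordinate
  expression of \<open>g \<circ> f\<close> is locally the composition of those of \<open>f\<close> and \<open>g\<close>.
\<close>

lemma coord_has_derivative_comp:
  assumes M: "differentiable_manifold M" and N: "differentiable_manifold N"
    and f: "differentiable_map_at M N f p" and g: "differentiable_map_at N L g (f p)"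
    and c: "c \<in> charts_at M p" and d: "d \<in> charts_at N (f p)" and e: "e \<in> charts_at L (g (f p))"
  shows "(snd e \<circ> (g \<circ> f) \<circ> chart_inv c has_derivative coord_deriv d e g (f p) \<circ> coord_deriv c d f p)
           (at (snd c p))"
proof -
  have c': "c \<in> atlas M" "p \<in> fst c" and d': "d \<in> atlas N" "f p \<in> fst d"
    using c d by (auto simp: charts_at_def)
  obtain A where A: "openin (mtop M) A" "p \<in> A" "f ` A \<subseteq> fst d"
    using differentiable_map_at_nbhd[OF f chart_domain_open[OF N d'(1)] d'(2)] .
  have "((snd d \<circ> f \<circ> chart_inv c) has_derivative coord_deriv c d f p) (at (snd c p))"
    by (rule differentiable_map_at_coord[OF f c d])
  moreover have "((snd e \<circ> g \<circ> chart_inv d) has_derivative coord_deriv d e g (f p)) (at (snd d (f p)))"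
    by (rule differentiable_map_at_coord[OF g d e])
  moreover have "(snd d \<circ> f \<circ> chart_inv c) (snd c p) = snd d (f p)"
    using M c' by simp
  ultimately have "((snd e \<circ> g \<circ> chart_inv d) \<circ> (snd d \<circ> f \<circ> chart_inv c)
      has_derivative coord_deriv d e g (f p) \<circ> coord_deriv c d f p) (at (snd c p))"
    by (intro diff_chain_at) auto
  then show ?thesis
  proof (rule has_derivative_transform_within_open)
    show "open (snd c ` (A \<inter> fst c))"
      by (intro open_chart_image[OF M] c' A)
    show "snd c p \<in> snd c ` (A \<inter> fst c)"
      using A c' by simp
    show "(snd e \<circ> g \<circ> chart_inv d \<circ> (snd d \<circ> f \<circ> chart_inv c)) x = (snd e \<circ> (g \<circ> f) \<circ> chart_inv c) x"
      if "x \<in> snd c ` (A \<inter> fst c)" for x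
    proof -
      obtain q where q: "q \<in> A" "q \<in> fst c" "x = snd c q"
        using \<open>x \<in> snd c ` (A \<inter> fst c)\<close> by blast
      moreover have "f q \<in> fst d"
        using A q by blast
      ultimately show ?thesis
        using M N c' d' by simp
    qed
  qed
qed

lemma coord_deriv_comp:
  assumes "differentiable_manifold M" "differentiable_manifold N"
    and "differentiable_map_at M N f p" "differentiable_map_at N L g (f p)"
    and "c \<in> charts_at M p" "d \<in> charts_at N (f p)" "e \<in> charts_at L (g (f p))"
  shows "coord_deriv c e (g \<circ> f) p v = coord_deriv d e g (f p) (coord_deriv c d f p v)"
  using fun_cong[OF frechet_derivative_at[OF coord_has_derivative_comp[OF assms], symmetric], of v]
  by (simp only: comp_apply)

lemma differentiable_map_at_comp:
  assumes M: "differentiable_manifold M" and N: "differentiable_manifold N"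
    and f: "differentiable_map_at M N f p" and g: "differentiable_map_at N L g (f p)"
  shows "differentiable_map_at M L (g \<circ> f) p"
proof -
  obtain d where d: "d \<in> charts_at N (f p)"
    by (rule ex_chart_at[OF N differentiable_map_at_points(2)[OF f]])
  have "\<exists>A. openin (mtop M) A \<and> p \<in> A \<and> (g \<circ> f) ` A \<subseteq> W" if W: "openin (mtop L) W" "g (f p) \<in> W" for W
  proof -
    obtain B where "openin (mtop N) B" "f p \<in> B" "g ` B \<subseteq> W"
      using differentiable_map_at_nbhd[OF g W] .
    moreover obtain A where "openin (mtop M) A" "p \<in> A" "f ` A \<subseteq> B"
      using differentiable_map_at_nbhd[OF f \<open>openin (mtop N) B\<close> \<open>f p \<in> B\<close>] .
    ultimately show ?thesis
      by (intro exI[of _ A]) auto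
  qed
  moreover have "(snd e \<circ> (g \<circ> f) \<circ> chart_inv c) differentiable (at (snd c p))"
    if "c \<in> charts_at M p" "e \<in> charts_at L (g (f p))" for c e
    using coord_has_derivative_comp[OF M N f g that(1) d that(2)] unfolding differentiable_def by blast
  ultimately show ?thesis
    using differentiable_map_at_points[OF f] differentiable_map_at_points[OF g]
    by (simp add: differentiable_map_at_def)
qed

lemma differentiable_map_at_id:
  assumes "differentiable_manifold M" "p \<in> mspc M"
  shows "differentiable_map_at M M id p"
  using assms by (auto simp: differentiable_map_at_def differentiable_manifold_def charts_at_def)

lemma coord_deriv_id:
  assumes M: "differentiable_manifold M" and c: "c \<in> charts_at M p"
  shows "coord_deriv c c id p = id"
proof -
  have c': "c \<in> atlas M" "p \<in> fst c"
    using c by (auto simp: charts_at_def)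
  have "openin (mtop M) (fst c)"
    using M c' by (simp add: chart_domain_open)
  then have "open (snd c ` fst c)"
    using open_chart_image[OF M c'(1), of "fst c"] by simp
  then have "(snd c \<circ> id \<circ> chart_inv c has_derivative id) (at (snd c p))"
    using c' M by (auto intro: has_derivative_transform_within_open[OF has_derivative_id])
  then show ?thesis
    using frechet_derivative_at by metis
qed

section \<open>Tangent vectors and differentials\<close>

text \<open>
  A coordinate change is the coordinate expression of the identity map. In this form the facts about
  tangent vectors become instances of the chain rule.
\<close>

lemma tangent_space_iff:
  "v \<in> tangent_space M p \<longleftrightarrow>
     (\<forall>c. c \<notin> charts_at M p \<longrightarrow> v c = 0) \<and>
     (\<forall>c\<in>charts_at M p. \<forall>d\<in>charts_at M p. v d = coord_deriv c d id p (v c))"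
  by (simp add: tangent_space_def)

lemma tangent_vector_eqI:
  assumes v: "v \<in> tangent_space M p" and w: "w \<in> tangent_space M p"
    and c: "c \<in> charts_at M p" and eq: "v c = w c"
  shows "v = w"
proof
  fix d
  have "v d = coord_deriv c d id p (v c)" "w d = coord_deriv c d id p (w c)" if "d \<in> charts_at M p"
    using v w c that unfolding tangent_space_iff by blast+
  moreover have "v d = 0" "w d = 0" if "d \<notin> charts_at M p"
    using v w that unfolding tangent_space_iff by blast+
  ultimately show "v d = w d"
    using eq by (cases "d \<in> charts_at M p") simp_all
qed

text \<open>
  The component \<open>w\<close> in one chart is transported to the other charts; the chain rule for coordinate
  changes shows that the resulting family is compatible.
\<close>

lemma ex_tangent_vector:
  assumes M: "differentiable_manifold M" and c: "c \<in> charts_at M p"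
  shows "\<exists>v\<in>tangent_space M p. v c = w"
proof -
  define v where "v d = (if d \<in> charts_at M p then coord_deriv c d id p w else 0)" for d
  have id: "differentiable_map_at M M id p"
    using differentiable_map_at_id[OF M] M c by (auto simp: differentiable_manifold_def charts_at_def)
  have "v e = coord_deriv d e id p (v d)" if "d \<in> charts_at M p" "e \<in> charts_at M p" for d e
    using coord_deriv_comp[OF M M id, of M id c d e w] id c that by (simp add: v_def)
  then have "v \<in> tangent_space M p"
    unfolding tangent_space_iff using v_def by metis
  moreover have "v c = w"
    using coord_deriv_id[OF M c] c by (simp add: v_def)
  ultimately show ?thesis
    by blast
qed

lemma tangent_space_zero:
  assumes M: "differentiable_manifold M"
  shows "0 \<in> tangent_space M p"
proof -
  have "coord_deriv c d id p 0 = 0" if "c \<in> charts_at M p" "d \<in> charts_at M p" for c d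
  proof -
    have "differentiable_map_at M M id p"
      using differentiable_map_at_id[OF M] M that by (auto simp: differentiable_manifold_def charts_at_def)
    then show ?thesis
      using coord_deriv_linear[of M M id p c d] that linear_0 by auto
  qed
  then show ?thesis
    by (auto simp: tangent_space_iff)
qed

lemma tangent_space_add_diff:
  assumes M: "differentiable_manifold M" and v: "v \<in> tangent_space M p" and w: "w \<in> tangent_space M p"
  shows "v + w \<in> tangent_space M p" and "v - w \<in> tangent_space M p"
proof -
  have lin: "linear (coord_deriv c d id p)" if "c \<in> charts_at M p" "d \<in> charts_at M p" for c d
  proof -
    have "differentiable_map_at M M id p"
      using differentiable_map_at_id[OF M] M that by (auto simp: differentiable_manifold_def charts_at_def)
    then show ?thesis
      using coord_deriv_linear[of M M id p c d] that by auto
  qed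
  have z: "v c = 0" "w c = 0" if "c \<notin> charts_at M p" for c
    using v w that unfolding tangent_space_iff by blast+
  have t: "v d = coord_deriv c d id p (v c)" "w d = coord_deriv c d id p (w c)"
    if "c \<in> charts_at M p" "d \<in> charts_at M p" for c d
    using v w that unfolding tangent_space_iff by blast+
  show "v + w \<in> tangent_space M p"
    unfolding tangent_space_iff
  proof (intro conjI allI ballI impI)
    show "(v + w) c = 0" if "c \<notin> charts_at M p" for c
      using z[OF that] by simp
    show "(v + w) d = coord_deriv c d id p ((v + w) c)" if cd: "c \<in> charts_at M p" "d \<in> charts_at M p" for c d
      unfolding plus_fun_apply linear_add[OF lin[OF cd]] by (intro arg_cong2[of _ _ _ _ "(+)"] t cd)
  qed
  show "v - w \<in> tangent_space M p"
    unfolding tangent_space_iff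
  proof (intro conjI allI ballI impI)
    show "(v - w) c = 0" if "c \<notin> charts_at M p" for c
      using z[OF that] by simp
    show "(v - w) d = coord_deriv c d id p ((v - w) c)" if cd: "c \<in> charts_at M p" "d \<in> charts_at M p" for c d
      unfolding fun_diff_def linear_diff[OF lin[OF cd]] by (intro arg_cong2[of _ _ _ _ "(-)"] t cd)
  qed
qed

abbreviation differential ::
    "('p, 'e::model_space) manifold \<Rightarrow> ('q, 'f::model_space) manifold \<Rightarrow> ('p \<Rightarrow> 'q) \<Rightarrow> 'p
      \<Rightarrow> (('p, 'e) chart \<Rightarrow> 'e) \<Rightarrow> ('q, 'f) chart \<Rightarrow> 'f" where
  "differential M N f p v \<equiv> snd (tangent_map M N f (p, v))"

lemma fst_tangent_map [simp]: "fst (tangent_map M N f (p, v)) = f p"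
  by (simp add: tangent_map_def)

lemma tangent_map_image: "tangent_map M N f ` ({p} \<times> T) = {f p} \<times> differential M N f p ` T"
  by (force simp: tangent_map_def)

text \<open>
  The definition of the tangent map picks a chart at the base point; for compatible families the
  choice is irrelevant, which frees later arguments from it.
\<close>

lemma differential_component:
  assumes M: "differentiable_manifold M"
    and f: "differentiable_map_at M N f p" and v: "v \<in> tangent_space M p"
    and c: "c \<in> charts_at M p" and d: "d \<in> charts_at N (f p)"
  shows "differential M N f p v d = coord_deriv c d f p (v c)"
proof -
  define c0 where "c0 = (SOME c. c \<in> charts_at M p)"
  have c0: "c0 \<in> charts_at M p"
    unfolding c0_def using c by (rule someI)
  have id: "differentiable_map_at M M id p"
    using differentiable_map_at_id[OF M] f by (auto simp: differentiable_map_at_def)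
  have "differential M N f p v d = coord_deriv c0 d f p (v c0)"
    using d by (simp add: tangent_map_def c0_def Let_def)
  also have "\<dots> = coord_deriv c d f p (coord_deriv c0 c id p (v c0))"
    using coord_deriv_comp[OF M M id, of N f c0 c d "v c0"] f c0 c d by simp
  also have "coord_deriv c0 c id p (v c0) = v c"
    using v c0 c unfolding tangent_space_iff by metis
  finally show ?thesis .
qed

lemma differential_in_tangent_space:
  assumes M: "differentiable_manifold M" and N: "differentiable_manifold N"
    and f: "differentiable_map_at M N f p" and v: "v \<in> tangent_space M p"
  shows "differential M N f p v \<in> tangent_space N (f p)"
proof -
  obtain c where c: "c \<in> charts_at M p"
    by (rule ex_chart_at[OF M differentiable_map_at_points(1)[OF f]])
  have id: "differentiable_map_at N N id (f p)"
    using differentiable_map_at_id[OF N] f by (auto simp: differentiable_map_at_def)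
  have "differential M N f p v e = coord_deriv d e id (f p) (differential M N f p v d)"
    if "d \<in> charts_at N (f p)" "e \<in> charts_at N (f p)" for d e
    using coord_deriv_comp[OF M N f, of N id c d e] id c that differential_component[OF M f v c]
    by simp
  moreover have "differential M N f p v d = 0" if "d \<notin> charts_at N (f p)" for d
    using that by (simp add: tangent_map_def)
  ultimately show ?thesis
    unfolding tangent_space_iff by blast
qed

lemma differential_comp:
  assumes M: "differentiable_manifold M" and N: "differentiable_manifold N"
    and f: "differentiable_map_at M N f p" and g: "differentiable_map_at N L g (f p)"
    and v: "v \<in> tangent_space M p"
  shows "differential N L g (f p) (differential M N f p v) = differential M L (g \<circ> f) p v"
proof
  fix e
  obtain c where c: "c \<in> charts_at M p"
    by (rule ex_chart_at[OF M differentiable_map_at_points(1)[OF f]])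
  obtain d where d: "d \<in> charts_at N (f p)"
    by (rule ex_chart_at[OF N differentiable_map_at_points(2)[OF f]])
  have w: "differential M N f p v \<in> tangent_space N (f p)"
    by (rule differential_in_tangent_space[OF M N f v])
  have gf: "differentiable_map_at M L (g \<circ> f) p"
    by (rule differentiable_map_at_comp[OF M N f g])
  show "differential N L g (f p) (differential M N f p v) e = differential M L (g \<circ> f) p v e"
  proof (cases "e \<in> charts_at L (g (f p))")
    case True
    then show ?thesis
      using differential_component[OF N g w d True] differential_component[OF M f v c d]
        differential_component[OF M gf v c, of e] coord_deriv_comp[OF M N f g c d True]
      by simp
  qed (simp add: tangent_map_def)
qed

lemma differential_cong:
  assumes M: "differentiable_manifold M" and f: "differentiable_map_at M N f p"
    and A: "openin (mtop M) A" "p \<in> A" and eq: "\<And>x. x \<in> A \<Longrightarrow> f x = g x"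
    and v: "v \<in> tangent_space M p"
  shows "differential M N f p v = differential M N g p v"
proof
  fix d
  have gp: "f p = g p"
    using A eq by simp
  obtain c where c: "c \<in> charts_at M p"
    by (rule ex_chart_at[OF M differentiable_map_at_points(1)[OF f]])
  have g: "differentiable_map_at M N g p"
    using differentiable_map_at_cong(1)[OF M f A] eq by blast
  show "differential M N f p v d = differential M N g p v d"
  proof (cases "d \<in> charts_at N (f p)")
    case True
    then show ?thesis
      using differential_component[OF M f v c] differential_component[OF M g v c] gp
        differentiable_map_at_cong(2)[OF M f A eq c] by simp
  qed (simp add: tangent_map_def gp)
qed

lemma differential_id:
  assumes M: "differentiable_manifold M" and p: "p \<in> mspc M" and v: "v \<in> tangent_space M p"
  shows "differential M M id p v = v"
proof -
  obtain c where c: "c \<in> charts_at M p"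
    by (rule ex_chart_at[OF M p])
  have id: "differentiable_map_at M M id p"
    by (rule differentiable_map_at_id[OF M p])
  have "differential M M id p v c = v c"
    using differential_component[OF M id v c, of c] c coord_deriv_id[OF M c] by simp
  moreover have "differential M M id p v \<in> tangent_space M p"
    using differential_in_tangent_space[OF M M id v] by simp
  ultimately show ?thesis
    using tangent_vector_eqI[OF _ v c] by blast
qed

lemma differential_const:
  fixes M :: "('p, 'e::model_space) manifold" and N :: "('q, 'f::model_space) manifold"
  shows "differential M N (\<lambda>_. q) p v = 0"
proof
  fix d :: "('q, 'f) chart"
  have "snd d \<circ> (\<lambda>_. q) \<circ> chart_inv c = (\<lambda>_. snd d q)" for c :: "('p, 'e) chart"
    by (simp add: fun_eq_iff)
  then show "differential M N (\<lambda>_. q) p v d = 0 d"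
    by (simp add: tangent_map_def Let_def)
qed

lemma differential_diff:
  assumes M: "differentiable_manifold M" and f: "differentiable_map_at M N f p"
    and v: "v \<in> tangent_space M p" and w: "w \<in> tangent_space M p"
  shows "differential M N f p (v - w) = differential M N f p v - differential M N f p w"
proof
  fix d
  obtain c where c: "c \<in> charts_at M p"
    by (rule ex_chart_at[OF M differentiable_map_at_points(1)[OF f]])
  show "differential M N f p (v - w) d
      = (differential M N f p v - differential M N f p w) d"
  proof (cases "d \<in> charts_at N (f p)")
    case True
    then show ?thesis
      using differential_component[OF M f _ c True] tangent_space_add_diff(2)[OF M v w] v w
        linear_diff[OF coord_deriv_linear[OF f c True]] by simp
  qed (simp add: tangent_map_def)
qed

lemma differential_zero:
  assumes M: "differentiable_manifold M" and f: "differentiable_map_at M N f p"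
  shows "differential M N f p 0 = 0"
  using differential_diff[OF M f tangent_space_zero[OF M] tangent_space_zero[OF M]] by simp

section \<open>Products of manifolds\<close>

abbreviation prod_chart ::
    "('p, 'e) chart \<Rightarrow> ('q, 'f) chart \<Rightarrow> ('p \<times> 'q, 'e \<times> 'f) chart" where
  "prod_chart c d \<equiv> (fst c \<times> fst d, map_prod (snd c) (snd d))"

lemma atlas_prod_manifold:
  "atlas (prod_manifold M N) = {prod_chart c d | c d. c \<in> atlas M \<and> d \<in> atlas N}"
  by (auto simp: prod_manifold_def)

lemma mtop_prod_manifold [simp]:
  "mtop (prod_manifold M N) = prod_topology (mtop M) (mtop N)"
  by (simp add: prod_manifold_def)

lemma charts_at_prod_manifold:
  fixes M :: "('p, 'e) manifold" and N :: "('q, 'f) manifold"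
  shows "charts_at (prod_manifold M N) (p, q) = {prod_chart c d | c d. c \<in> charts_at M p \<and> d \<in> charts_at N q}"
proof -
  have "(p, q) \<in> fst (prod_chart c d) \<longleftrightarrow> p \<in> fst c \<and> q \<in> fst d" for c :: "('p, 'e) chart" and d :: "('q, 'f) chart"
    by simp
  then show ?thesis
    unfolding charts_at_def atlas_prod_manifold by blast
qed

lemma chart_inv_prod_chart:
  assumes M: "differentiable_manifold M" and N: "differentiable_manifold N"
    and "c \<in> atlas M" "d \<in> atlas N" "x \<in> snd c ` fst c" "y \<in> snd d ` fst d"
  shows "chart_inv (prod_chart c d) (x, y) = (chart_inv c x, chart_inv d y)"
proof -
  obtain p q where pq: "p \<in> fst c" "x = snd c p" "q \<in> fst d" "y = snd d q"
    using assms by blast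
  have "inj_on (map_prod (snd c) (snd d)) (fst c \<times> fst d)"
    using assms by (intro map_prod_inj_on chart_inj_on)
  then have "inv_into (fst c \<times> fst d) (map_prod (snd c) (snd d)) (map_prod (snd c) (snd d) (p, q)) = (p, q)"
    using pq by (intro inv_into_f_f) auto
  then show ?thesis
    using assms pq by (simp add: chart_inv_def[of "prod_chart c d"])
qed

lemma has_derivative_comp_fst:
  assumes "(\<phi> has_derivative D) (at x)"
  shows "((\<lambda>z. \<phi> (fst z)) has_derivative (\<lambda>z. D (fst z))) (at (x, y))"
proof -
  have "(fst has_derivative fst) (at (x, y))"
    by (rule bounded_linear_imp_has_derivative[OF bounded_linear_fst])
  then show ?thesis
    by (rule has_derivative_compose) (simp add: assms)
qed

lemma has_derivative_comp_snd:
  assumes "(\<phi> has_derivative D) (at y)"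
  shows "((\<lambda>z. \<phi> (snd z)) has_derivative (\<lambda>z. D (snd z))) (at (x, y))"
proof -
  have "(snd has_derivative snd) (at (x, y))"
    by (rule bounded_linear_imp_has_derivative[OF bounded_linear_snd])
  then show ?thesis
    by (rule has_derivative_compose) (simp add: assms)
qed

lemma differentiable_manifold_prod:
  assumes M: "differentiable_manifold M" and N: "differentiable_manifold N"
  shows "differentiable_manifold (prod_manifold M N)"
  unfolding differentiable_manifold_def
proof (intro conjI ballI)
  let ?P = "prod_manifold M N"
  have "(\<Union>c\<in>atlas ?P. fst c) = (\<Union>c\<in>atlas M. fst c) \<times> (\<Union>d\<in>atlas N. fst d)"
    unfolding atlas_prod_manifold by force
  then show "(\<Union>c\<in>atlas ?P. fst c) = mspc ?P"
    using M N by (simp add: differentiable_manifold_def)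
  fix k
  assume "k \<in> atlas ?P"
  then obtain c d where k: "k = prod_chart c d" and c: "c \<in> atlas M" and d: "d \<in> atlas N"
    unfolding atlas_prod_manifold by blast
  have oc: "open (snd c ` fst c)" and od: "open (snd d ` fst d)"
    using M N c d by (auto simp: differentiable_manifold_def)
  have im: "snd k ` fst k = (snd c ` fst c) \<times> (snd d ` fst d)"
    by (auto simp: k)
  show "openin (mtop ?P) (fst k)"
    using chart_domain_open[OF M c] chart_domain_open[OF N d] by (simp add: k openin_prod_Times_iff)
  show "open (snd k ` fst k)"
    unfolding im by (intro open_Times oc od)
  obtain c' d' where
    "homeomorphic_maps (subtopology (mtop M) (fst c)) (top_of_set (snd c ` fst c)) (snd c) c'"
    "homeomorphic_maps (subtopology (mtop N) (fst d)) (top_of_set (snd d ` fst d)) (snd d) d'"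
    using chart_homeomorphic[OF M c] chart_homeomorphic[OF N d] unfolding homeomorphic_map_maps by blast
  then have "homeomorphic_maps (prod_topology (subtopology (mtop M) (fst c)) (subtopology (mtop N) (fst d)))
      (prod_topology (top_of_set (snd c ` fst c)) (top_of_set (snd d ` fst d)))
      (\<lambda>(x, y). (snd c x, snd d y)) (\<lambda>(x, y). (c' x, d' y))"
    unfolding homeomorphic_maps_prod by blast
  then show "homeomorphic_map (subtopology (mtop ?P) (fst k)) (top_of_set (snd k ` fst k)) (snd k)"
    unfolding im by (auto simp: k subtopology_Times homeomorphic_map_maps map_prod_def)
  fix k' z
  assume k'P: "k' \<in> atlas ?P" and z: "z \<in> fst k \<inter> fst k'"
  obtain e h where k': "k' = prod_chart e h" and e: "e \<in> atlas M" and h: "h \<in> atlas N"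
    using k'P unfolding atlas_prod_manifold by blast
  obtain p q where z_eq: "z = (p, q)"
    by (cases z)
  have pq: "p \<in> fst c \<inter> fst e" "q \<in> fst d \<inter> fst h"
    using z by (auto simp: k k' z_eq)
  obtain D E where D: "((snd e \<circ> chart_inv c) has_derivative D) (at (snd c p))"
      and E: "((snd h \<circ> chart_inv d) has_derivative E) (at (snd d q))"
    using M N c d e h pq unfolding differentiable_manifold_def differentiable_def by blast
  have "((\<lambda>x. ((snd e \<circ> chart_inv c) (fst x), (snd h \<circ> chart_inv d) (snd x)))
      has_derivative (\<lambda>x. (D (fst x), E (snd x)))) (at (snd c p, snd d q))"
    by (rule has_derivative_Pair[OF has_derivative_comp_fst[OF D] has_derivative_comp_snd[OF E]])
  then have "(snd k' \<circ> chart_inv k has_derivative (\<lambda>x. (D (fst x), E (snd x)))) (at (snd c p, snd d q))"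
  proof (rule has_derivative_transform_within_open)
    show "open ((snd c ` fst c) \<times> (snd d ` fst d))"
      by (intro open_Times oc od)
    show "(snd c p, snd d q) \<in> (snd c ` fst c) \<times> (snd d ` fst d)"
      using pq by simp
    show "((snd e \<circ> chart_inv c) (fst x), (snd h \<circ> chart_inv d) (snd x)) = (snd k' \<circ> chart_inv k) x"
      if "x \<in> (snd c ` fst c) \<times> (snd d ` fst d)" for x
      using that chart_inv_prod_chart[OF M N c d] by (auto simp: k k')
  qed
  then show "(snd k' \<circ> chart_inv k) differentiable (at (snd k z))"
    unfolding differentiable_def k z_eq by auto
qed

context
  fixes M :: "('p, 'e::model_space) manifold" and N :: "('q, 'f::model_space) manifold"
    and p :: 'p and q :: 'q
  assumes M: "differentiable_manifold M" and N: "differentiable_manifold N"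
    and p: "p \<in> mspc M" and q: "q \<in> mspc N"
begin

lemma coord_has_derivative_fst:
  assumes c: "c \<in> charts_at M p" and d: "d \<in> charts_at N q" and e: "e \<in> charts_at M p"
  shows "(snd e \<circ> fst \<circ> chart_inv (prod_chart c d) has_derivative (\<lambda>z. coord_deriv c e id p (fst z)))
           (at (snd c p, snd d q))"
proof -
  have c': "c \<in> atlas M" "p \<in> fst c" and d': "d \<in> atlas N" "q \<in> fst d"
    using c d by (auto simp: charts_at_def)
  have "((snd e \<circ> id \<circ> chart_inv c) has_derivative coord_deriv c e id p) (at (snd c p))"
    using differentiable_map_at_coord[OF differentiable_map_at_id[OF M p] c] e by simp
  then have "((\<lambda>x. (snd e \<circ> id \<circ> chart_inv c) (fst x)) has_derivative (\<lambda>x. coord_deriv c e id p (fst x)))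
      (at (snd c p, snd d q))"
    by (rule has_derivative_comp_fst)
  then show ?thesis
  proof (rule has_derivative_transform_within_open)
    show "open ((snd c ` fst c) \<times> (snd d ` fst d))"
      using M N c' d' by (intro open_Times) (auto simp: differentiable_manifold_def)
    show "(snd c p, snd d q) \<in> (snd c ` fst c) \<times> (snd d ` fst d)"
      using c' d' by simp
    show "(snd e \<circ> id \<circ> chart_inv c) (fst x) = (snd e \<circ> fst \<circ> chart_inv (prod_chart c d)) x"
      if "x \<in> (snd c ` fst c) \<times> (snd d ` fst d)" for x
      using that chart_inv_prod_chart[OF M N c'(1) d'(1)] by auto
  qed
qed

lemma coord_has_derivative_snd:
  assumes c: "c \<in> charts_at M p" and d: "d \<in> charts_at N q" and e: "e \<in> charts_at N q"
  shows "(snd e \<circ> snd \<circ> chart_inv (prod_chart c d) has_derivative (\<lambda>z. coord_deriv d e id q (snd z)))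
           (at (snd c p, snd d q))"
proof -
  have c': "c \<in> atlas M" "p \<in> fst c" and d': "d \<in> atlas N" "q \<in> fst d"
    using c d by (auto simp: charts_at_def)
  have "((snd e \<circ> id \<circ> chart_inv d) has_derivative coord_deriv d e id q) (at (snd d q))"
    using differentiable_map_at_coord[OF differentiable_map_at_id[OF N q] d] e by simp
  then have "((\<lambda>x. (snd e \<circ> id \<circ> chart_inv d) (snd x)) has_derivative (\<lambda>x. coord_deriv d e id q (snd x)))
      (at (snd c p, snd d q))"
    by (rule has_derivative_comp_snd)
  then show ?thesis
  proof (rule has_derivative_transform_within_open)
    show "open ((snd c ` fst c) \<times> (snd d ` fst d))"
      using M N c' d' by (intro open_Times) (auto simp: differentiable_manifold_def)
    show "(snd c p, snd d q) \<in> (snd c ` fst c) \<times> (snd d ` fst d)"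
      using c' d' by simp
    show "(snd e \<circ> id \<circ> chart_inv d) (snd x) = (snd e \<circ> snd \<circ> chart_inv (prod_chart c d)) x"
      if "x \<in> (snd c ` fst c) \<times> (snd d ` fst d)" for x
      using that chart_inv_prod_chart[OF M N c'(1) d'(1)] by auto
  qed
qed

lemma differentiable_map_at_fst: "differentiable_map_at (prod_manifold M N) M fst (p, q)"
proof -
  have "\<exists>A. openin (prod_topology (mtop M) (mtop N)) A \<and> (p, q) \<in> A \<and> fst ` A \<subseteq> W"
    if "openin (mtop M) W" "p \<in> W" for W
    using that q by (intro exI[of _ "W \<times> mspc N"]) (auto simp: openin_prod_Times_iff)
  moreover have "(snd e \<circ> fst \<circ> chart_inv (prod_chart c d)) differentiable (at (snd c p, snd d q))"
    if "c \<in> charts_at M p" "d \<in> charts_at N q" "e \<in> charts_at M p" for c d e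
    using coord_has_derivative_fst[OF that] unfolding differentiable_def by blast
  ultimately show ?thesis
    using p q unfolding differentiable_map_at_def charts_at_prod_manifold by auto
qed

lemma differentiable_map_at_snd: "differentiable_map_at (prod_manifold M N) N snd (p, q)"
proof -
  have "\<exists>A. openin (prod_topology (mtop M) (mtop N)) A \<and> (p, q) \<in> A \<and> snd ` A \<subseteq> W"
    if "openin (mtop N) W" "q \<in> W" for W
    using that p by (intro exI[of _ "mspc M \<times> W"]) (auto simp: openin_prod_Times_iff)
  moreover have "(snd e \<circ> snd \<circ> chart_inv (prod_chart c d)) differentiable (at (snd c p, snd d q))"
    if "c \<in> charts_at M p" "d \<in> charts_at N q" "e \<in> charts_at N q" for c d e
    using coord_has_derivative_snd[OF that] unfolding differentiable_def by blast
  ultimately show ?thesis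
    using p q unfolding differentiable_map_at_def charts_at_prod_manifold by auto
qed

text \<open>
  In the product chart and its factors, the two projections are the linear projections.
\<close>

lemma differential_projections_component:
  assumes u: "u \<in> tangent_space (prod_manifold M N) (p, q)"
    and c: "c \<in> charts_at M p" and d: "d \<in> charts_at N q"
  shows "u (prod_chart c d)
    = (differential (prod_manifold M N) M fst (p, q) u c, differential (prod_manifold M N) N snd (p, q) u d)"
proof -
  note P = differentiable_manifold_prod[OF M N]
  have cd: "prod_chart c d \<in> charts_at (prod_manifold M N) (p, q)"
    using c d unfolding charts_at_prod_manifold by blast
  have "coord_deriv (prod_chart c d) c fst (p, q) = fst"
    using frechet_derivative_at[OF coord_has_derivative_fst[OF c d c]] coord_deriv_id[OF M c] by simp
  moreover have "coord_deriv (prod_chart c d) d snd (p, q) = snd"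
    using frechet_derivative_at[OF coord_has_derivative_snd[OF c d d]] coord_deriv_id[OF N d] by simp
  ultimately show ?thesis
    using differential_component[OF P differentiable_map_at_fst u cd, of c]
      differential_component[OF P differentiable_map_at_snd u cd, of d] c d
    by (simp add: prod_eq_iff)
qed

lemma tangent_prod_eq_zero:
  assumes u: "u \<in> tangent_space (prod_manifold M N) (p, q)"
    and "differential (prod_manifold M N) M fst (p, q) u = 0"
    and "differential (prod_manifold M N) N snd (p, q) u = 0"
  shows "u = 0"
proof -
  obtain c where c: "c \<in> charts_at M p"
    by (rule ex_chart_at[OF M p])
  obtain d where d: "d \<in> charts_at N q"
    by (rule ex_chart_at[OF N q])
  show ?thesis
  proof (rule tangent_vector_eqI[OF u])
    show "0 \<in> tangent_space (prod_manifold M N) (p, q)"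
      by (intro tangent_space_zero differentiable_manifold_prod M N)
    show "prod_chart c d \<in> charts_at (prod_manifold M N) (p, q)"
      using c d unfolding charts_at_prod_manifold by blast
    show "u (prod_chart c d) = 0 (prod_chart c d)"
      using differential_projections_component[OF u c d] assms by (simp add: zero_prod_def)
  qed
qed

lemma differential_snd_surj:
  assumes w: "w \<in> tangent_space N q"
  shows "\<exists>u\<in>tangent_space (prod_manifold M N) (p, q). differential (prod_manifold M N) N snd (p, q) u = w"
proof -
  note P = differentiable_manifold_prod[OF M N]
  obtain c where c: "c \<in> charts_at M p"
    by (rule ex_chart_at[OF M p])
  obtain d where d: "d \<in> charts_at N q"
    by (rule ex_chart_at[OF N q])
  have "prod_chart c d \<in> charts_at (prod_manifold M N) (p, q)"
    using c d unfolding charts_at_prod_manifold by blast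
  then obtain u where u: "u \<in> tangent_space (prod_manifold M N) (p, q)" "u (prod_chart c d) = (0, w d)"
    using ex_tangent_vector[OF P] by blast
  have "differential (prod_manifold M N) N snd (p, q) u = w"
  proof (rule tangent_vector_eqI[OF _ w d])
    show "differential (prod_manifold M N) N snd (p, q) u \<in> tangent_space N q"
      using differential_in_tangent_space[OF P N differentiable_map_at_snd u(1)] by simp
    show "differential (prod_manifold M N) N snd (p, q) u d = w d"
      using differential_projections_component[OF u(1) c d] u(2) by simp
  qed
  with u show ?thesis
    by blast
qed

end

text \<open>
  A coordinate expression of \<open>snd \<circ> f\<close> uses a chart of \<open>L\<close> only, one of \<open>f\<close> also a chart of \<open>N\<close>. Its
  domain is therefore covered by the domains belonging to the various charts of \<open>N\<close>, on each of which it
  is a linear projection of a coordinate expression of \<open>f\<close>.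
\<close>

lemma smooth_map_snd_comp:
  assumes M: "differentiable_manifold M" and N: "differentiable_manifold N" and L: "differentiable_manifold L"
    and f: "smooth_map M A (prod_manifold N L) (V \<times> W) f" and W: "openin (mtop L) W"
  shows "smooth_map M A L W (snd \<circ> f)"
proof -
  have A: "openin (mtop M) A" and cont: "continuous_map (subtopology (mtop M) A)
      (prod_topology (subtopology (mtop N) V) (subtopology (mtop L) W)) f"
    using f by (auto simp: smooth_map_def subtopology_Times)
  have cover: "\<exists>d\<in>atlas N. fst (f p) \<in> fst d" if "p \<in> A" for p
  proof -
    have "f p \<in> mspc N \<times> mspc L"
      using differentiable_map_at_points(2)[OF smooth_map_differentiable_at[OF f that]] by simp
    then have "fst (f p) \<in> (\<Union>d\<in>atlas N. fst d)"
      using N by (auto simp: differentiable_manifold_def)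
    then show ?thesis
      by blast
  qed
  have "smooth_on (snd c ` (A \<inter> fst c \<inter> (snd \<circ> f) -` fst e)) (snd e \<circ> (snd \<circ> f) \<circ> chart_inv c)"
    if c: "c \<in> atlas M" and e: "e \<in> atlas L" for c e
  proof -
    let ?T = "\<lambda>d. snd c ` (A \<inter> fst c \<inter> f -` fst (prod_chart d e))"
    have "open (?T d) \<and> smooth_on (?T d) (snd e \<circ> (snd \<circ> f) \<circ> chart_inv c)" if d: "d \<in> atlas N" for d
    proof -
      have "openin (mtop (prod_manifold N L)) (fst (prod_chart d e))"
        using chart_domain_open[OF N d] chart_domain_open[OF L e] by (simp add: openin_prod_Times_iff)
      then have "open (snd c ` ((A \<inter> f -` fst (prod_chart d e)) \<inter> fst c))"
        by (intro open_chart_image[OF M c] open_preimage_smooth_map[OF f])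
      then have op: "open (?T d)"
        by (simp add: Int_ac)
      have "smooth_on (?T d) (snd (prod_chart d e) \<circ> f \<circ> chart_inv c)"
        using d e by (intro smooth_map_coord[OF f c]) (unfold atlas_prod_manifold, blast)
      then have "smooth_on (?T d) (snd \<circ> (snd (prod_chart d e) \<circ> f \<circ> chart_inv c))"
        by (rule smooth_on_bounded_linear[OF bounded_linear_snd op])
      moreover have "snd \<circ> (snd (prod_chart d e) \<circ> f \<circ> chart_inv c) = snd e \<circ> (snd \<circ> f) \<circ> chart_inv c"
        by (simp add: fun_eq_iff)
      ultimately show ?thesis
        using op by simp
    qed
    then have "smooth_on (\<Union>(?T ` atlas N)) (snd e \<circ> (snd \<circ> f) \<circ> chart_inv c)"
      by (intro smooth_on_open_Union) blast
    moreover have "\<Union>(?T ` atlas N) = snd c ` (A \<inter> fst c \<inter> (snd \<circ> f) -` fst e)"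
    proof (intro equalityI subsetI)
      fix x
      assume "x \<in> snd c ` (A \<inter> fst c \<inter> (snd \<circ> f) -` fst e)"
      then obtain r where r: "x = snd c r" "r \<in> A" "r \<in> fst c" "snd (f r) \<in> fst e"
        by auto
      obtain d where "d \<in> atlas N" "fst (f r) \<in> fst d"
        using cover[OF \<open>r \<in> A\<close>] by blast
      with r show "x \<in> \<Union>(?T ` atlas N)"
        by (auto simp: mem_Times_iff intro!: bexI[of _ d])
    qed (auto simp: mem_Times_iff)
    ultimately show ?thesis
      by simp
  qed
  moreover have "continuous_map (subtopology (mtop M) A) (subtopology (mtop L) W) (snd \<circ> f)"
    using cont by (rule continuous_map_snd_of)
  ultimately show ?thesis
    using A W by (auto simp: smooth_map_def)
qed

section \<open>First integrals from complete solutions\<close>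

theorem theorem4p3:
  fixes M :: "('m, 'a::model_space) manifold"
    and N :: "('n, 'b::model_space) manifold"
    and \<Lambda> :: "('l, 'c::model_space) manifold"
    and X :: "'m \<Rightarrow> ('m, 'a) tangent"
    and Pr :: "'m \<Rightarrow> 'n"
    and \<Sigma> :: "'n \<times> 'l \<Rightarrow> 'm"
  assumes "dynamical_system M X"
    and "smooth_manifold N"
    and "fibration M (mspc M) N (mspc N) Pr"
    and "complete_solution M X N Pr \<Lambda> \<Sigma>"
    and "m \<in> mspc M"
  shows "\<exists>U F. openin (mtop M) U \<and> m \<in> U \<and>
           F ` U \<subseteq> mspc \<Lambda> \<and> fibration M U \<Lambda> (F ` U) F \<and>
           X ` U \<subseteq> tangent_kernel_bundle M U \<Lambda> F \<and>
           transverse M U N Pr \<Lambda> F \<and>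
           \<Sigma> ` (Pr ` U \<times> F ` U) \<subseteq> U \<and>
           diffeomorphism (prod_manifold N \<Lambda>) (Pr ` U \<times> F ` U) M U \<Sigma> \<and>
           (\<forall>z\<in>Pr ` U \<times> F ` U. (F \<circ> \<Sigma>) z = snd z)"
proof -
  let ?P = "prod_manifold N \<Lambda>"
  have M: "differentiable_manifold M" and N: "differentiable_manifold N" and \<Lambda>: "differentiable_manifold \<Lambda>"
    using assms unfolding dynamical_system_def complete_solution_def
    by (blast intro: smooth_imp_differentiable_manifold)+
  note P = differentiable_manifold_prod[OF N \<Lambda>]
  have X: "fst (X p) = p" "snd (X p) \<in> tangent_space M p" if "p \<in> mspc M" for p
    using assms(1) that by (auto simp: dynamical_system_def vector_field_def)
  have local: "local_diffeomorphism ?P M \<Sigma>" and surj: "\<Sigma> ` (mspc N \<times> mspc \<Lambda>) = mspc M"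
    and HJE: "\<And>l. l \<in> mspc \<Lambda> \<Longrightarrow> HJE_solution M X N Pr (\<lambda>n. \<Sigma> (n, l))"
    using assms(4) by (auto simp: complete_solution_def)
  have Pr_\<Sigma>: "Pr (\<Sigma> (n, l)) = n" if "n \<in> mspc N" "l \<in> mspc \<Lambda>" for n l
    using HJE[OF that(2)] that(1) by (simp add: HJE_solution_def smooth_section_def)

  obtain n0 l0 where nl0: "n0 \<in> mspc N" "l0 \<in> mspc \<Lambda>" "m = \<Sigma> (n0, l0)"
    using surj assms(5) by blast
  then have "(n0, l0) \<in> mspc ?P"
    by simp
  then obtain A B where A: "(n0, l0) \<in> A" "diffeomorphism ?P A M B \<Sigma>"
    using local unfolding local_diffeomorphism_def by blast
  then have "openin (prod_topology (mtop N) (mtop \<Lambda>)) A"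
    by (simp add: diffeomorphism_def smooth_map_def)
  then obtain V W where V: "openin (mtop N) V" "n0 \<in> V" and W: "openin (mtop \<Lambda>) W" "l0 \<in> W"
    and VW: "V \<times> W \<subseteq> A"
    using A(1) unfolding openin_prod_topology_alt by meson
  have VW_open: "openin (mtop ?P) (V \<times> W)"
    using V W by (simp add: openin_prod_Times_iff)
  have V_sub: "V \<subseteq> mspc N" and W_sub: "W \<subseteq> mspc \<Lambda>"
    using V W openin_subset by blast+

  define U where "U = \<Sigma> ` (V \<times> W)"
  define G where "G = inv_into (V \<times> W) \<Sigma>"
  define F where "F = snd \<circ> G"
  have U: "openin (mtop M) U" and diffeo: "diffeomorphism ?P (V \<times> W) M U \<Sigma>"
    using diffeomorphism_restrict[OF P M A(2) VW_open VW] by (simp_all add: U_def)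
  have inj: "inj_on \<Sigma> (V \<times> W)" and \<Sigma>_smooth: "smooth_map ?P (V \<times> W) M U \<Sigma>"
    and G_smooth: "smooth_map M U ?P (V \<times> W) G"
    using diffeo by (auto simp: diffeomorphism_def bij_betw_def G_def)
  have G_\<Sigma>: "G (\<Sigma> z) = z" if "z \<in> V \<times> W" for z
    using inj that by (simp add: G_def)
  have F_\<Sigma>: "F (\<Sigma> (n, l)) = l" if "n \<in> V" "l \<in> W" for n l
    using G_\<Sigma>[of "(n, l)"] that by (simp add: F_def)
  have Pr_V: "Pr (\<Sigma> (n, l)) = n" if "n \<in> V" "l \<in> W" for n l
    using Pr_\<Sigma> that V_sub W_sub by blast
  have U_E: "\<exists>n\<in>V. \<exists>l\<in>W. p = \<Sigma> (n, l)" if "p \<in> U" for p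
    using that by (auto simp: U_def)
  have FU: "F ` U = W" and PrU: "Pr ` U = V"
    using V W F_\<Sigma> Pr_V by (force simp: U_def)+
  have F_smooth: "smooth_map M U \<Lambda> W F"
    unfolding F_def by (rule smooth_map_snd_comp[OF M N \<Lambda> G_smooth W(1)])

  have Pr_diff: "differentiable_map_at M N Pr p" if "p \<in> U" for p
    using assms(3) that U openin_subset
    by (auto simp: fibration_def intro!: smooth_map_differentiable_at)
  have F_diff: "differentiable_map_at M \<Lambda> F p" if "p \<in> U" for p
    by (rule smooth_map_differentiable_at[OF F_smooth that])
  have \<sigma>_diff: "differentiable_map_at N M (\<lambda>n. \<Sigma> (n, l)) n" if "n \<in> V" "l \<in> W" for n l
    using HJE[of l] that V_sub W_sub
    by (auto simp: HJE_solution_def smooth_section_def intro!: smooth_map_differentiable_at)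

  \<comment> \<open>Along a leaf, \<open>Pr\<close> is the identity of \<open>V\<close> and \<open>F\<close> is constant.\<close>
  have leaf: "differential M N Pr (\<Sigma> (n, l)) (differential N M (\<lambda>n. \<Sigma> (n, l)) n x) = x"
    "differential M \<Lambda> F (\<Sigma> (n, l)) (differential N M (\<lambda>n. \<Sigma> (n, l)) n x) = 0"
    "differential N M (\<lambda>n. \<Sigma> (n, l)) n x \<in> tangent_space M (\<Sigma> (n, l))"
    if n: "n \<in> V" and l: "l \<in> W" and x: "x \<in> tangent_space N n" for n l x
  proof -
    let ?\<sigma> = "\<lambda>n. \<Sigma> (n, l)"
    have p: "?\<sigma> n \<in> U"
      using n l by (auto simp: U_def)
    note \<sigma> = \<sigma>_diff[OF n l]
    show "differential N M ?\<sigma> n x \<in> tangent_space M (?\<sigma> n)"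
      by (rule differential_in_tangent_space[OF N M \<sigma> x])
    have "differential N N (Pr \<circ> ?\<sigma>) n x = differential N N id n x"
      using differentiable_map_at_comp[OF N M \<sigma> Pr_diff[OF p]] V(1) n _ x
      by (rule differential_cong[OF N]) (simp add: Pr_V l)
    then show "differential M N Pr (?\<sigma> n) (differential N M ?\<sigma> n x) = x"
      using differential_comp[OF N M \<sigma> Pr_diff[OF p] x] differential_id[OF N _ x] n V_sub by auto
    have "differential N \<Lambda> (F \<circ> ?\<sigma>) n x = differential N \<Lambda> (\<lambda>_. l) n x"
      using differentiable_map_at_comp[OF N M \<sigma> F_diff[OF p]] V(1) n _ x
      by (rule differential_cong[OF N]) (simp add: F_\<Sigma> l)
    then show "differential M \<Lambda> F (?\<sigma> n) (differential N M ?\<sigma> n x) = 0"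
      using differential_comp[OF N M \<sigma> F_diff[OF p] x] differential_const[of N \<Lambda> l] by simp
  qed

  have F_fib: "fibration M U \<Lambda> (F ` U) F"
    unfolding fibration_def
  proof (intro conjI ballI)
    show "smooth_map M U \<Lambda> (F ` U) F"
      using F_smooth by (simp add: FU)
    fix p
    assume p: "p \<in> U"
    then obtain n l where nl: "n \<in> V" "l \<in> W" "p = \<Sigma> (n, l)"
      using U_E by blast
    then have nl_in: "n \<in> mspc N" "l \<in> mspc \<Lambda>"
      using V_sub W_sub by auto
    have \<Sigma>: "differentiable_map_at ?P M \<Sigma> (n, l)"
      using nl by (intro smooth_map_differentiable_at[OF \<Sigma>_smooth]) simp
    have "w \<in> differential M \<Lambda> F p ` tangent_space M p" if w: "w \<in> tangent_space \<Lambda> (F p)" for w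
    proof -
      have "w \<in> tangent_space \<Lambda> l"
        using w nl F_\<Sigma> by simp
      then obtain u where u: "u \<in> tangent_space ?P (n, l)" "differential ?P \<Lambda> snd (n, l) u = w"
        using differential_snd_surj[OF N \<Lambda> nl_in] by blast
      have "differential M \<Lambda> F p (differential ?P M \<Sigma> (n, l) u) = differential ?P \<Lambda> (F \<circ> \<Sigma>) (n, l) u"
        using differential_comp[OF P M \<Sigma> _ u(1)] F_diff[OF p] nl by simp
      also have "\<dots> = differential ?P \<Lambda> snd (n, l) u"
        by (rule differential_cong[OF P differentiable_map_at_comp[OF P M \<Sigma>] VW_open])
          (use F_diff[OF p] nl F_\<Sigma> u in auto)
      finally have "differential M \<Lambda> F p (differential ?P M \<Sigma> (n, l) u) = w"
        using u by simp
      moreover have "differential ?P M \<Sigma> (n, l) u \<in> tangent_space M p"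
        using differential_in_tangent_space[OF P M \<Sigma> u(1)] nl by simp
      ultimately show ?thesis
        by blast
    qed
    then have "differential M \<Lambda> F p ` tangent_space M p = tangent_space \<Lambda> (F p)"
      using differential_in_tangent_space[OF M \<Lambda> F_diff[OF p]] by blast
    then show "tangent_map M \<Lambda> F ` ({p} \<times> tangent_space M p) = {F p} \<times> tangent_space \<Lambda> (F p)"
      unfolding tangent_map_image by simp
  qed simp

  have X_ker: "X ` U \<subseteq> tangent_kernel_bundle M U \<Lambda> F"
  proof
    fix y
    assume "y \<in> X ` U"
    then obtain n l where nl: "n \<in> V" "l \<in> W" and y: "y = X (\<Sigma> (n, l))"
      using U_E by blast
    let ?p = "\<Sigma> (n, l)"
    have p: "?p \<in> U"
      using nl by (auto simp: U_def)
    have p_in: "?p \<in> mspc M"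
      using p openin_subset[OF U] by blast
    obtain v where v: "X ?p = (?p, v)" "v \<in> tangent_space M ?p"
      using X[OF p_in] by (metis prod.collapse)
    have "tangent_map N M (\<lambda>n. \<Sigma> (n, l)) (tangent_map M N Pr (X ?p)) = X ?p"
      using HJE[of l] nl V_sub W_sub by (auto simp: HJE_solution_def)
    moreover have "tangent_map M N Pr (X ?p) = (n, differential M N Pr ?p v)"
      using nl by (simp add: v prod_eq_iff Pr_V)
    ultimately have "differential N M (\<lambda>n. \<Sigma> (n, l)) n (differential M N Pr ?p v) = v"
      by (simp add: v)
    moreover have "differential M N Pr ?p v \<in> tangent_space N n"
      using differential_in_tangent_space[OF M N Pr_diff[OF p] v(2)] nl by (simp add: Pr_V)
    ultimately have "differential M \<Lambda> F ?p v = 0"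
      using leaf(2)[OF nl] by metis
    then show "y \<in> tangent_kernel_bundle M U \<Lambda> F"
      using v p by (simp add: y tangent_kernel_bundle_def tangent_kernel_def)
  qed

  have trans: "transverse M U N Pr \<Lambda> F"
    unfolding transverse_def direct_sum_def
  proof (intro ballI conjI)
    fix p
    assume p: "p \<in> U"
    then obtain n l where nl: "n \<in> V" "l \<in> W" "p = \<Sigma> (n, l)"
      using U_E by blast
    have Prp: "Pr p = n" and Gp: "G p = (n, l)"
      using nl Pr_V G_\<Sigma> by auto
    let ?K = "tangent_kernel M N Pr p" and ?L = "tangent_kernel M \<Lambda> F p"
    have "v \<in> {a + b | a b. a \<in> ?K \<and> b \<in> ?L}" if v: "v \<in> tangent_space M p" for v
    proof -
      define b where "b = differential N M (\<lambda>n. \<Sigma> (n, l)) n (differential M N Pr p v)"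
      have "differential M N Pr p v \<in> tangent_space N n"
        using differential_in_tangent_space[OF M N Pr_diff[OF p] v] by (simp add: Prp)
      note b = leaf[OF nl(1,2) this, folded nl(3) b_def]
      have "b \<in> ?L"
        using b by (simp add: tangent_kernel_def)
      moreover have "v - b \<in> ?K"
        using b v differential_diff[OF M Pr_diff[OF p] v b(3)] tangent_space_add_diff(2)[OF M v b(3)]
        by (simp add: tangent_kernel_def)
      moreover have "v = (v - b) + b"
        by simp
      ultimately show ?thesis
        by blast
    qed
    then show "tangent_space M p = {a + b | a b. a \<in> ?K \<and> b \<in> ?L}"
      using tangent_space_add_diff(1)[OF M] by (auto simp: tangent_kernel_def)
    have "v = 0" if "v \<in> ?K" "v \<in> ?L" for v
    proof -
      have v: "v \<in> tangent_space M p" "differential M N Pr p v = 0" "differential M \<Lambda> F p v = 0"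
        using that by (auto simp: tangent_kernel_def)
      have nl_in: "n \<in> mspc N" "l \<in> mspc \<Lambda>"
        using nl V_sub W_sub by auto
      have Gd: "differentiable_map_at M ?P G p"
        by (rule smooth_map_differentiable_at[OF G_smooth p])
      have \<Sigma>d: "differentiable_map_at ?P M \<Sigma> (G p)"
        unfolding Gp using nl by (intro smooth_map_differentiable_at[OF \<Sigma>_smooth]) simp
      define u where "u = differential M ?P G p v"
      have u: "u \<in> tangent_space ?P (n, l)"
        using differential_in_tangent_space[OF M P Gd v(1)] by (simp add: u_def Gp)
      have "differential ?P N fst (n, l) u = differential M N (fst \<circ> G) p v"
        using differential_comp[OF M P Gd _ v(1)] differentiable_map_at_fst[OF N \<Lambda> nl_in]
        by (simp add: u_def Gp)
      also have "\<dots> = differential M N Pr p v"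
      proof (rule sym, rule differential_cong[OF M Pr_diff[OF p] U p _ v(1)])
        show "Pr x = (fst \<circ> G) x" if "x \<in> U" for x
          using U_E[OF that] Pr_V G_\<Sigma> by auto
      qed
      finally have 1: "differential ?P N fst (n, l) u = 0"
        using v by simp
      have "differential ?P \<Lambda> snd (n, l) u = differential M \<Lambda> F p v"
        using differential_comp[OF M P Gd _ v(1)] differentiable_map_at_snd[OF N \<Lambda> nl_in]
        by (simp add: u_def Gp F_def)
      then have "u = 0"
        using tangent_prod_eq_zero[OF N \<Lambda> nl_in u 1] v by simp
      have "v = differential M M id p v"
        using differential_id[OF M _ v(1)] p U openin_subset by fastforce
      also have "\<dots> = differential M M (\<Sigma> \<circ> G) p v"
      proof (rule differential_cong[OF M differentiable_map_at_id[OF M] U p _ v(1)])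
        show "p \<in> mspc M"
          using p U openin_subset by blast
        show "id x = (\<Sigma> \<circ> G) x" if "x \<in> U" for x
          using U_E[OF that] G_\<Sigma> by auto
      qed
      also have "\<dots> = differential ?P M \<Sigma> (n, l) u"
        using differential_comp[OF M P Gd \<Sigma>d v(1)] by (simp add: u_def Gp)
      also have "\<dots> = 0"
        using differential_zero[OF P \<Sigma>d] \<open>u = 0\<close> by (simp add: Gp)
      finally show ?thesis .
    qed
    moreover have "0 \<in> ?K" "0 \<in> ?L"
      using differential_zero[OF M Pr_diff[OF p]] differential_zero[OF M F_diff[OF p]] tangent_space_zero[OF M]
      by (auto simp: tangent_kernel_def)
    ultimately show "?K \<inter> ?L = {0}"
      by blast
  qed

  have "m \<in> U"
    using nl0 V W by (auto simp: U_def)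
  moreover have "(F \<circ> \<Sigma>) z = snd z" if "z \<in> V \<times> W" for z
    using that F_\<Sigma> by auto
  ultimately show ?thesis
    using U F_fib X_ker trans diffeo W_sub
    by (intro exI[of _ U] exI[of _ F]) (simp add: FU PrU, simp add: U_def)
qed

end
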